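(* Let $G_0$ be the connected simply connected real Lie group with Lie algebra $\mathcal{G}_{6,3}$ (basis $x_1,\dots,x_6$, nonzero brackets $[x_1,x_2]=x_4$, $[x_1,x_3]=x_5$, $[x_2,x_3]=x_6$), with the global coordinates $(x^1,y^1,x^2,y^2,x^3,y^3)$ given by $$x=\exp(x^1x_1)\exp(y^1x_2)\exp(x^2x_3)\exp(y^2x_4)\exp(x^3x_5)\exp(y^3x_6).$$ Let $G$ be $G_0$ endowed with the left invariant structure of complex manifold defined by the complex structure $J_0$ on $\mathcal{G}_{6,3}$ with $J_0x_1=x_2$, $J_0x_3=x_4$, $J_0x_5=x_6$. Put $z^j=x^j+iy^j$ for $1\le j\le3$ and $$w^1=z^1,\qquad w^2=z^2+\frac{|z^1|^2}{4}-\frac{(\overline{z^1})^2}{8},\qquad w^3=z^3.$$ Then $w^1,w^2,w^3$ are holomorphic functions on $G$, and $F=(w^1,w^2,w^3):G\to\mathbb{C}^3$ is a biholomorphic bijection, hence a global holomorphic chart on $G$.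
   Context: Brackets of basis vectors not listed (and not obtained by antisymmetry) are zero. A complex structure on a real Lie algebra $\mathfrak{g}$ is a linear map $J$ with $J^2=-1$ and $[JX,JY]-[X,Y]-J[JX,Y]-J[X,JY]=0$ for all $X,Y\in\mathfrak{g}$. It extends uniquely to a left invariant almost complex structure on $G_0$, which is integrable by the Newlander–Nirenberg theorem; $G$ denotes $G_0$ with the resulting complex manifold structure. A smooth function $f:G_0\to\mathbb{C}$ is holomorphic on $G$ if and only if $(X+iJX)f=0$ for all left invariant vector fields $X$, where the left invariant vector field associated with $x_j$ is $(X_jf)(x)=\frac{d}{dt}f(x\exp(tx_j))|_{t=0}$. *)

theory Defs
  imports "HOL-Analysis.Analysis"
begin

section \<open>Smooth maps, Lie groups and almost complex structures on Euclidean spaces\<close>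

primrec Ck_on :: "nat \<Rightarrow> 'a::real_normed_vector set \<Rightarrow> ('a \<Rightarrow> 'b::real_normed_vector) \<Rightarrow> bool"
  where
    "Ck_on 0 S f \<longleftrightarrow> continuous_on S f"
  | "Ck_on (Suc k) S f \<longleftrightarrow>
       (\<forall>x\<in>S. f differentiable (at x)) \<and> (\<forall>v. Ck_on k S (\<lambda>x. frechet_derivative f (at x) v))"

text \<open>Only used for open \<open>S\<close> in finite dimension, where it is the usual notion of \<open>C\<^sup>\<infinity>\<close>.\<close>

definition smooth_on :: "'a::real_normed_vector set \<Rightarrow> ('a \<Rightarrow> 'b::real_normed_vector) \<Rightarrow> bool"
  where "smooth_on S f \<longleftrightarrow> (\<forall>k. Ck_on k S f)"

text \<open>A Lie group whose underlying manifold is a Euclidean space (hence connected and simply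
  connected). Every tangent space is identified with \<open>'a\<close>.\<close>

locale euclidean_lie_group =
  fixes mult :: "'a::euclidean_space \<Rightarrow> 'a \<Rightarrow> 'a" (infixl "\<odot>" 70)
    and unit :: 'a
    and ginv :: "'a \<Rightarrow> 'a"
  assumes smooth_mult: "smooth_on UNIV (\<lambda>(x, y). x \<odot> y)"
    and smooth_ginv: "smooth_on UNIV ginv"
    and assoc: "(x \<odot> y) \<odot> z = x \<odot> (y \<odot> z)"
    and left_unit: "unit \<odot> x = x"
    and left_inverse: "ginv x \<odot> x = unit"
begin

definition one_parameter_subgroup :: "'a \<Rightarrow> (real \<Rightarrow> 'a) \<Rightarrow> bool"
  where "one_parameter_subgroup X \<gamma> \<longleftrightarrow>
    smooth_on UNIV \<gamma> \<and> (\<forall>s t. \<gamma> (s + t) = \<gamma> s \<odot> \<gamma> t) \<and> (\<gamma> has_vector_derivative X) (at 0)"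

definition lexp :: "'a \<Rightarrow> 'a"
  where "lexp X = (THE \<gamma>. one_parameter_subgroup X \<gamma>) 1"

text \<open>The left invariant vector field with value \<open>X\<close> at the unit: as a tangent vector field, and
  as an operator on complex functions.\<close>

definition left_field :: "'a \<Rightarrow> 'a \<Rightarrow> 'a"
  where "left_field X x = frechet_derivative (\<lambda>y. x \<odot> y) (at unit) X"

definition left_deriv :: "'a \<Rightarrow> ('a \<Rightarrow> complex) \<Rightarrow> 'a \<Rightarrow> complex"
  where "left_deriv X f x = vector_derivative (\<lambda>t. f (x \<odot> lexp (t *\<^sub>R X))) (at 0)"

text \<open>The commutator \<open>DY(X) - DX(Y)\<close> of the left invariant vector fields, taken at the unit.\<close>

definition lie_bracket :: "'a \<Rightarrow> 'a \<Rightarrow> 'a"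
  where "lie_bracket X Y = frechet_derivative (left_field Y) (at unit) X
                         - frechet_derivative (left_field X) (at unit) Y"

text \<open>The left invariant almost complex structure extending \<open>J\<close>, with \<open>dL\<close> the differential of a
  left translation: \<open>dL\<^sub>x \<circ> J \<circ> dL\<^sub>x\<^sup>-\<^sup>1\<close> on the tangent space at \<open>x\<close>.\<close>

definition left_acs :: "('a \<Rightarrow> 'a) \<Rightarrow> 'a \<Rightarrow> 'a \<Rightarrow> 'a"
  where "left_acs J x v =
    frechet_derivative (\<lambda>y. x \<odot> y) (at unit) (J (frechet_derivative (\<lambda>y. ginv x \<odot> y) (at x) v))"

definition holomorphic_function :: "('a \<Rightarrow> 'a) \<Rightarrow> ('a \<Rightarrow> complex) \<Rightarrow> bool"
  where "holomorphic_function J f \<longleftrightarrow>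
    smooth_on UNIV f \<and> (\<forall>X x. left_deriv X f x + \<i> * left_deriv (J X) f x = 0)"

end

definition complex_structure ::
    "('a::real_vector \<Rightarrow> 'a \<Rightarrow> 'a) \<Rightarrow> ('a \<Rightarrow> 'a) \<Rightarrow> bool"
  where "complex_structure br J \<longleftrightarrow> linear J \<and> (\<forall>X. J (J X) = - X) \<and>
    (\<forall>X Y. br (J X) (J Y) - br X Y - J (br (J X) Y) - J (br X (J Y)) = 0)"

text \<open>For integrable almost complex structures \<open>JA\<close>, \<open>JB\<close> these are the holomorphic maps of the
  underlying complex manifolds.\<close>

definition holomorphic_map_on ::
    "('a::real_normed_vector \<Rightarrow> 'a \<Rightarrow> 'a) \<Rightarrow> ('b::real_normed_vector \<Rightarrow> 'b \<Rightarrow> 'b)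
      \<Rightarrow> 'a set \<Rightarrow> ('a \<Rightarrow> 'b) \<Rightarrow> bool"
  where "holomorphic_map_on JA JB U f \<longleftrightarrow> smooth_on U f \<and>
    (\<forall>x\<in>U. \<forall>v. frechet_derivative f (at x) (JA x v) = JB (f x) (frechet_derivative f (at x) v))"

definition biholomorphic ::
    "('a::real_normed_vector \<Rightarrow> 'a \<Rightarrow> 'a) \<Rightarrow> ('b::real_normed_vector \<Rightarrow> 'b \<Rightarrow> 'b)
      \<Rightarrow> 'a set \<Rightarrow> 'b set \<Rightarrow> ('a \<Rightarrow> 'b) \<Rightarrow> bool"
  where "biholomorphic JA JB U V f \<longleftrightarrow> open U \<and> open V \<and> bij_betw f U V \<and>
    holomorphic_map_on JA JB U f \<and> holomorphic_map_on JB JA V (inv_into U f)"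

definition std_acs :: "complex^'n \<Rightarrow> complex^'n \<Rightarrow> complex^'n"
  where "std_acs z v = \<i> *s v"

definition holomorphic_chart ::
    "('a::real_normed_vector \<Rightarrow> 'a \<Rightarrow> 'a) \<Rightarrow> 'a set \<Rightarrow> ('a \<Rightarrow> complex^'n) \<Rightarrow> bool"
  where "holomorphic_chart JA U \<phi> \<longleftrightarrow> biholomorphic JA std_acs U (\<phi> ` U) \<phi>"

lemma linear_Ck_on:
  fixes f :: "'a::euclidean_space \<Rightarrow> 'b::real_normed_vector"
  assumes "linear f"
  shows "Ck_on k UNIV f"
proof -
  have bl: "bounded_linear f"
    using assms by (simp add: linear_conv_bounded_linear)
  have const: "Ck_on j UNIV (\<lambda>x::'a. c)" for j and c :: 'b
    by (induction j arbitrary: c) (auto simp: frechet_derivative_const)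
  have D: "(f has_derivative f) (at x)" for x
    using bounded_linear_imp_has_derivative[OF bl] .
  then have "frechet_derivative f (at x) v = f v" for x v
    by (rule fun_cong[OF frechet_derivative_at, symmetric])
  then show ?thesis
    using D bl const
    by (cases k) (auto simp: differentiable_def linear_continuous_on)
qed


section \<open>The Lie algebra and its simply connected Lie group\<close>

abbreviation bv :: "6 \<Rightarrow> real^6"
  where "bv i \<equiv> axis i 1"

text \<open>Bilinear antisymmetric extension of the bracket table, see \<open>bracket63_basis\<close>. Note that the
  index \<open>6\<close> equals \<open>0\<close> in the index type \<open>6\<close>.\<close>

definition bracket63 :: "real^6 \<Rightarrow> real^6 \<Rightarrow> real^6"
  where "bracket63 u v = (u$1 * v$2 - u$2 * v$1) *\<^sub>R bv 4
                       + (u$1 * v$3 - u$3 * v$1) *\<^sub>R bv 5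
                       + (u$2 * v$3 - u$3 * v$2) *\<^sub>R bv 6"

definition J0 :: "real^6 \<Rightarrow> real^6"
  where "J0 v = v$1 *\<^sub>R bv 2 - v$2 *\<^sub>R bv 1 + v$3 *\<^sub>R bv 4 - v$4 *\<^sub>R bv 3
              + v$5 *\<^sub>R bv 6 - v$6 *\<^sub>R bv 5"

text \<open>The connected simply connected Lie group is realised on the Lie algebra itself by the
  Baker--Campbell--Hausdorff product, which stops after the first bracket since the algebra is
  2-step nilpotent. That this is a Lie group with the given Lie algebra is proved below
  (interpretation \<open>G0\<close> and \<open>lie_bracket_G0\<close>).\<close>

definition mult63 :: "real^6 \<Rightarrow> real^6 \<Rightarrow> real^6"
  where "mult63 u v = u + v + (1/2) *\<^sub>R bracket63 u v"

lemma exhaust_6: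
  fixes x :: 6
  shows "x = 1 \<or> x = 2 \<or> x = 3 \<or> x = 4 \<or> x = 5 \<or> x = 6"
proof (induct x)
  case (of_int z)
  then have "0 \<le> z" and "z < 6" by simp_all
  then have "z = 0 \<or> z = 1 \<or> z = 2 \<or> z = 3 \<or> z = 4 \<or> z = 5" by arith
  then show ?case by auto
qed

lemma forall_6: "(\<forall>i::6. P i) \<longleftrightarrow> P 1 \<and> P 2 \<and> P 3 \<and> P 4 \<and> P 5 \<and> P 6"
  by (metis exhaust_6)

lemma bracket63_nth [simp]:
  "bracket63 u v $ 1 = 0" "bracket63 u v $ 2 = 0" "bracket63 u v $ 3 = 0"
  "bracket63 u v $ 4 = u$1 * v$2 - u$2 * v$1"
  "bracket63 u v $ 5 = u$1 * v$3 - u$3 * v$1"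
  "bracket63 u v $ 6 = u$2 * v$3 - u$3 * v$2"
  by (simp_all add: bracket63_def axis_def)

lemma J0_nth [simp]:
  "J0 v $ 1 = - v$2" "J0 v $ 2 = v$1" "J0 v $ 3 = - v$4"
  "J0 v $ 4 = v$3" "J0 v $ 5 = - v$6" "J0 v $ 6 = v$5"
  by (simp_all add: J0_def axis_def)

lemma bracket63_basis:
  "bracket63 (bv 1) (bv 2) = bv 4" "bracket63 (bv 1) (bv 3) = bv 5" "bracket63 (bv 2) (bv 3) = bv 6"
  "bracket63 u v = - bracket63 v u"
  "i \<in> {4, 5, 6} \<Longrightarrow> bracket63 (bv i) v = 0"
  by (auto simp: vec_eq_iff forall_6 axis_def)

lemma bilinear_bracket63: "bilinear bracket63"
  unfolding bilinear_def
  by (auto intro!: linearI simp: vec_eq_iff forall_6 algebra_simps)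

lemma J0_basis: "J0 (bv 1) = bv 2" "J0 (bv 3) = bv 4" "J0 (bv 5) = bv 6"
  by (auto simp: vec_eq_iff forall_6 axis_def)

lemma complex_structure_J0: "complex_structure bracket63 J0"
  unfolding complex_structure_def
  by (auto intro!: linearI simp: vec_eq_iff forall_6 algebra_simps)

lemma bounded_bilinear_bracket63: "bounded_bilinear bracket63"
  using bilinear_bracket63 by (simp add: bilinear_conv_bounded_bilinear)

lemma mult63_has_derivative:
  "((\<lambda>(x, y). mult63 x y) has_derivative
    (\<lambda>h. fst h + snd h + (1/2) *\<^sub>R (bracket63 (fst p) (snd h) + bracket63 (fst h) (snd p)))) (at p)"
  unfolding mult63_def case_prod_beta
  by (auto intro!: derivative_eq_intros bounded_bilinear.FDERIV[OF bounded_bilinear_bracket63])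

lemma smooth_mult63: "smooth_on UNIV (\<lambda>(x, y). mult63 x y)"
proof -
  let ?m = "\<lambda>(x, y). mult63 x y"
  have fd: "frechet_derivative ?m (at p) =
     (\<lambda>h. fst h + snd h + (1/2) *\<^sub>R (bracket63 (fst p) (snd h) + bracket63 (fst h) (snd p)))" for p
    using frechet_derivative_at[OF mult63_has_derivative] by simp
  have cont: "continuous_on UNIV ?m"
    by (intro continuous_at_imp_continuous_on ballI
        has_derivative_continuous[OF mult63_has_derivative])
  have lin: "Ck_on k UNIV (\<lambda>p. (1/2) *\<^sub>R (bracket63 (fst p) b + bracket63 a (snd p)))" for k a b
    by (rule linear_Ck_on)
      (auto intro!: linearI simp: vec_eq_iff forall_6 algebra_simps diff_divide_distrib add_divide_distrib)
  have "Ck_on k UNIV (\<lambda>p. c + (1/2) *\<^sub>R (bracket63 (fst p) b + bracket63 a (snd p)))" for k a b c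
  proof (cases k)
    case 0
    then show ?thesis using lin[of 0 b a] by (auto intro!: continuous_intros)
  next
    case (Suc j)
    define L where "L p = (1/2) *\<^sub>R (bracket63 (fst p) b + bracket63 a (snd p))" for p
    have L: "Ck_on (Suc j) UNIV L"
      using lin[of "Suc j" b a] by (simp only: L_def[abs_def])
    have d: "((\<lambda>p. c + L p) has_derivative frechet_derivative L (at x)) (at x)" for x
    proof -
      have "(L has_derivative frechet_derivative L (at x)) (at x)"
        using L unfolding Ck_on.simps frechet_derivative_works[symmetric] by blast
      from has_derivative_add[OF has_derivative_const[of c] this] show ?thesis by simp
    qed
    have D: "frechet_derivative (\<lambda>p. c + L p) (at x) = frechet_derivative L (at x)" for x
      by (rule frechet_derivative_at[OF d, symmetric])
    have "Ck_on (Suc j) UNIV (\<lambda>p. c + L p)"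
      using L unfolding Ck_on.simps D by (blast intro: differentiableI[OF d])
    then show ?thesis
      by (simp only: L_def Suc)
  qed
  then have "Ck_on (Suc k) UNIV ?m" for k
    unfolding Ck_on.simps fd by (blast intro: differentiableI[OF mult63_has_derivative])
  then show ?thesis
    unfolding smooth_on_def using cont by (metis Ck_on.simps(1) not0_implies_Suc)
qed

interpretation G0: euclidean_lie_group mult63 0 uminus
proof
  show "smooth_on UNIV (\<lambda>(x, y). mult63 x y)"
    by (rule smooth_mult63)
  show "smooth_on UNIV (uminus :: real^6 \<Rightarrow> real^6)"
    unfolding smooth_on_def by (auto intro!: linear_Ck_on linearI)
qed (auto simp: mult63_def vec_eq_iff forall_6 algebra_simps diff_divide_distrib add_divide_distrib)

lemma left_field_G0: "G0.left_field X x = X + (1/2) *\<^sub>R bracket63 x X"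
proof -
  have "((\<lambda>y. mult63 x y) has_derivative (\<lambda>h. h + (1/2) *\<^sub>R bracket63 x h)) (at 0)"
    unfolding mult63_def
    by (auto intro!: derivative_eq_intros
        bounded_linear.has_derivative[OF bounded_bilinear.bounded_linear_right[OF bounded_bilinear_bracket63]])
  then show ?thesis
    by (simp add: G0.left_field_def frechet_derivative_at[symmetric])
qed

lemma lie_bracket_G0: "G0.lie_bracket = bracket63"
proof (intro ext)
  fix X Y
  have "(G0.left_field Z has_derivative (\<lambda>h. (1/2) *\<^sub>R bracket63 h Z)) (at 0)" for Z
    unfolding left_field_G0[abs_def]
    by (auto intro!: derivative_eq_intros
        bounded_linear.has_derivative[OF bounded_bilinear.bounded_linear_left[OF bounded_bilinear_bracket63]])
  then have D: "frechet_derivative (G0.left_field Z) (at 0) h = (1/2) *\<^sub>R bracket63 h Z" for Z h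
    by (rule fun_cong[OF frechet_derivative_at, symmetric])
  show "G0.lie_bracket X Y = bracket63 X Y"
    unfolding G0.lie_bracket_def D by (simp add: vec_eq_iff forall_6 field_simps)
qed

lemma lexp_G0: "G0.lexp X = X"
proof -
  have sm: "smooth_on UNIV (\<lambda>t::real. t *\<^sub>R X)"
    unfolding smooth_on_def by (auto intro!: linear_Ck_on linearI simp: algebra_simps)
  have ex: "G0.one_parameter_subgroup X (\<lambda>t. t *\<^sub>R X)"
    unfolding G0.one_parameter_subgroup_def using sm
    by (auto simp: mult63_def vec_eq_iff forall_6 algebra_simps intro!: derivative_eq_intros)
  have un: "\<gamma> = (\<lambda>t. t *\<^sub>R X)" if "G0.one_parameter_subgroup X \<gamma>" for \<gamma>
  proof
    fix t
    have hom: "\<gamma> (s + t) = mult63 (\<gamma> s) (\<gamma> t)" for s t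
      using that unfolding G0.one_parameter_subgroup_def by auto
    have d0: "(\<gamma> has_vector_derivative X) (at 0)"
      using that unfolding G0.one_parameter_subgroup_def by auto
    have z: "\<gamma> 0 = 0"
      using hom[of 0 0] by (simp add: mult63_def vec_eq_iff forall_6)
    define \<delta> where "\<delta> s = \<gamma> s - s *\<^sub>R X" for s
    have d: "(\<delta> has_vector_derivative (1/2) *\<^sub>R bracket63 (\<delta> s) X) (at s)" for s
    proof -
      have "((\<lambda>t. \<gamma> (t - s)) has_vector_derivative X) (at s)"
      proof -
        have "((\<lambda>t. t - s) has_vector_derivative 1) (at s)"
          by (auto intro!: derivative_eq_intros)
        from vector_diff_chain_at[OF this, of \<gamma> X] show ?thesis
          using d0 by (simp add: o_def)
      qed
      then have "((\<lambda>t. mult63 (\<gamma> s) (\<gamma> (t - s))) has_vector_derivative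
                   X + (1/2) *\<^sub>R bracket63 (\<gamma> s) X) (at s)"
        unfolding mult63_def
        by (auto intro!: derivative_eq_intros
          bounded_linear.has_vector_derivative[OF bounded_bilinear.bounded_linear_right[OF bounded_bilinear_bracket63]])
      moreover have "(\<lambda>t. mult63 (\<gamma> s) (\<gamma> (t - s))) = \<gamma>"
        by (simp add: hom[symmetric])
      ultimately have "(\<gamma> has_vector_derivative X + (1/2) *\<^sub>R bracket63 (\<gamma> s) X) (at s)"
        by simp
      then have "(\<delta> has_vector_derivative (X + (1/2) *\<^sub>R bracket63 (\<gamma> s) X) - X) (at s)"
        unfolding \<delta>_def by (auto intro!: derivative_eq_intros)
      moreover have "bracket63 (\<gamma> s) X = bracket63 (\<delta> s) X"
        by (simp add: \<delta>_def vec_eq_iff forall_6 algebra_simps)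
      ultimately show ?thesis by simp
    qed
    have nth: "((\<lambda>s. \<delta> s $ i) has_vector_derivative ((1/2) *\<^sub>R bracket63 (\<delta> s) X) $ i) (at s)" for s i
      using bounded_linear.has_vector_derivative[OF bounded_linear_vec_nth d] .
    have zero: "\<delta> s $ i = 0" if "\<And>s. bracket63 (\<delta> s) X $ i = 0" for s i
    proof -
      have "((\<lambda>s. \<delta> s $ i) has_real_derivative 0) (at s)" for s
        using nth[of i s] that[of s] by (simp add: has_real_derivative_iff_has_vector_derivative)
      then have "\<delta> s $ i = \<delta> 0 $ i"
        by (intro DERIV_isconst_all allI)
      then show ?thesis by (simp add: \<delta>_def z)
    qed
    have low: "\<delta> s $ 1 = 0" "\<delta> s $ 2 = 0" "\<delta> s $ 3 = 0" for s
      by (rule zero; simp)+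
    have "bracket63 (\<delta> s) X $ i = 0" for s i
      using exhaust_6[of i] low[of s] by auto
    then have "\<delta> t = 0"
      using zero by (simp add: vec_eq_iff)
    then show "\<gamma> t = t *\<^sub>R X" by (simp add: \<delta>_def)
  qed
  have "(THE \<gamma>. G0.one_parameter_subgroup X \<gamma>) = (\<lambda>t. t *\<^sub>R X)"
    using ex un by (rule the_equality)
  then show ?thesis by (simp add: G0.lexp_def)
qed


section \<open>The coordinates\<close>

text \<open>The entries of \<open>a\<close> are \<open>x\<^sup>1, y\<^sup>1, x\<^sup>2, y\<^sup>2, x\<^sup>3, y\<^sup>3\<close> in this order.\<close>

definition point_of_coords :: "real^6 \<Rightarrow> real^6"
  where "point_of_coords a =
    mult63 (mult63 (mult63 (mult63 (mult63
      (G0.lexp (a$1 *\<^sub>R bv 1))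
      (G0.lexp (a$2 *\<^sub>R bv 2)))
      (G0.lexp (a$3 *\<^sub>R bv 3)))
      (G0.lexp (a$4 *\<^sub>R bv 4)))
      (G0.lexp (a$5 *\<^sub>R bv 5)))
      (G0.lexp (a$6 *\<^sub>R bv 6))"

definition coords :: "real^6 \<Rightarrow> real^6"
  where "coords = inv point_of_coords"

lemma bij_point_of_coords: "bij point_of_coords"
proof -
  define Q :: "real^6 \<Rightarrow> real^6" where
    "Q p = p - (1/2) *\<^sub>R ((p$1 * p$2) *\<^sub>R bv 4 + (p$1 * p$3) *\<^sub>R bv 5 + (p$2 * p$3) *\<^sub>R bv 6)" for p
  have P: "point_of_coords a =
      a + (1/2) *\<^sub>R ((a$1 * a$2) *\<^sub>R bv 4 + (a$1 * a$3) *\<^sub>R bv 5 + (a$2 * a$3) *\<^sub>R bv 6)" for a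
    unfolding point_of_coords_def lexp_G0
    by (simp add: mult63_def vec_eq_iff forall_6 axis_def)
  show ?thesis
    by (rule bij_betw_byWitness[where f' = Q])
       (auto simp: P Q_def vec_eq_iff forall_6 axis_def)
qed

definition z1 :: "real^6 \<Rightarrow> complex" where "z1 p = Complex (coords p $ 1) (coords p $ 2)"
definition z2 :: "real^6 \<Rightarrow> complex" where "z2 p = Complex (coords p $ 3) (coords p $ 4)"
definition z3 :: "real^6 \<Rightarrow> complex" where "z3 p = Complex (coords p $ 5) (coords p $ 6)"

definition w1 :: "real^6 \<Rightarrow> complex"
  where "w1 p = z1 p"

definition w2 :: "real^6 \<Rightarrow> complex"
  where "w2 p = z2 p + complex_of_real ((cmod (z1 p))\<^sup>2 / 4) - (cnj (z1 p))\<^sup>2 / 8"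

definition w3 :: "real^6 \<Rightarrow> complex"
  where "w3 p = z3 p"

definition F :: "real^6 \<Rightarrow> complex^3"
  where "F p = vector [w1 p, w2 p, w3 p]"

end

theory Submission
  imports Defs
begin

text \<open>In exponential coordinates \<open>p\<close> both \<open>F\<close> and its inverse are polynomial maps, so smoothness is
  automatic. The left translate of \<open>X\<close> to \<open>p\<close> is \<open>X + [p, X]/2\<close>, with inverse \<open>X - [p, X]/2\<close> by
  2-step nilpotency; hence holomorphy of \<open>F\<close> becomes the polynomial identity
  \<open>dF\<^sub>p (J\<^sub>0 X + [p, J\<^sub>0 X]/2) = i dF\<^sub>p (X + [p, X]/2)\<close>, and the \<open>w\<^sup>j\<close> are its components.\<close>

section \<open>Smoothness of polynomial maps\<close>

text \<open>Structural induction: the sum and product rules assemble the derivative, and each rule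
  visibly keeps its value in a fixed direction polynomial.\<close>

lemma real_polynomial_function_has_derivative:
  assumes "real_polynomial_function f"
  shows "\<exists>D. (\<forall>x. (f has_derivative D x) (at x)) \<and> (\<forall>v. real_polynomial_function (\<lambda>x. D x v))"
  using assms
proof (induction f rule: real_polynomial_function.induct)
  case (linear f)
  then show ?case
    by (intro exI[of _ "\<lambda>_. f"]) (auto intro: bounded_linear_imp_has_derivative)
next
  case (const c)
  then show ?case
    by (intro exI[of _ "\<lambda>_ _. 0"]) auto
next
  case (add f g)
  then obtain D E where "\<And>x. (f has_derivative D x) (at x)" "\<And>v. real_polynomial_function (\<lambda>x. D x v)"
    "\<And>x. (g has_derivative E x) (at x)" "\<And>v. real_polynomial_function (\<lambda>x. E x v)"
    by blast
  then show ?case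
    by (intro exI[of _ "\<lambda>x v. D x v + E x v"]) (auto intro: has_derivative_add)
next
  case (mult f g)
  then obtain D E where "\<And>x. (f has_derivative D x) (at x)" "\<And>v. real_polynomial_function (\<lambda>x. D x v)"
    "\<And>x. (g has_derivative E x) (at x)" "\<And>v. real_polynomial_function (\<lambda>x. E x v)"
    by blast
  \<comment> \<open>The product rule leaves \<open>f\<close> and \<open>g\<close> themselves as
    factors, so their own polynomiality is used besides the induction hypotheses.\<close>
  then show ?case using mult.hyps
    by (intro exI[of _ "\<lambda>x v. f x * E x v + D x v * g x"] conjI allI has_derivative_mult
        real_polynomial_function.intros(3,4))
qed

text \<open>Works one basis component at a time, where uniqueness of derivatives identifies the
  polynomial \<open>D\<close> with the component of the Frechet derivative. This closure property
  drives the recursion in \<open>Ck_on\<close>.\<close>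

lemma polynomial_function_frechet_derivative:
  fixes f :: "'a::real_normed_vector \<Rightarrow> 'b::euclidean_space"
  assumes "polynomial_function f"
  shows "polynomial_function (\<lambda>x. frechet_derivative f (at x) v)"
  unfolding polynomial_function_iff_Basis_inner
proof
  fix b :: 'b assume "b \<in> Basis"
  with assms have "real_polynomial_function (\<lambda>x. f x \<bullet> b)"
    unfolding polynomial_function_iff_Basis_inner by blast
  from real_polynomial_function_has_derivative[OF this]
  obtain D where D: "\<And>x. ((\<lambda>x. f x \<bullet> b) has_derivative D x) (at x)"
      and poly: "\<And>v. real_polynomial_function (\<lambda>x. D x v)"
    by blast
  have "(f has_derivative frechet_derivative f (at x)) (at x)" for x
    using differentiable_at_polynomial_function[OF assms] frechet_derivative_works by blast
  from has_derivative_unique[OF D has_derivative_inner_left[OF this]]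
  have "D x v = frechet_derivative f (at x) v \<bullet> b" for x
    by (rule fun_cong)
  then show "real_polynomial_function (\<lambda>x. frechet_derivative f (at x) v \<bullet> b)"
    using poly[of v] by simp
qed

lemma polynomial_function_Ck_on:
  fixes f :: "'a::real_normed_vector \<Rightarrow> 'b::euclidean_space"
  assumes "polynomial_function f"
  shows "Ck_on k S f"
  using assms
proof (induction k arbitrary: f)
  case 0
  then show ?case by (simp add: continuous_on_polymonial_function)
next
  case (Suc k)
  then show ?case
    by (simp add: differentiable_at_polynomial_function polynomial_function_frechet_derivative)
qed

lemma polynomial_function_smooth_on:
  fixes f :: "'a::real_normed_vector \<Rightarrow> 'b::euclidean_space"
  shows "polynomial_function f \<Longrightarrow> smooth_on S f"
  by (simp add: smooth_on_def polynomial_function_Ck_on)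

lemma smooth_on_has_derivative:
  assumes "smooth_on S f" "x \<in> S"
  shows "(f has_derivative frechet_derivative f (at x)) (at x)"
proof -
  have "Ck_on (Suc 0) S f"
    using assms(1) unfolding smooth_on_def by blast
  then show ?thesis
    using assms(2) frechet_derivative_works by auto
qed

lemma polynomial_function_vec_iff:
  fixes f :: "'a::real_normed_vector \<Rightarrow> 'b::euclidean_space^'n"
  shows "polynomial_function f \<longleftrightarrow> (\<forall>i. polynomial_function (\<lambda>x. f x $ i))"
  by (auto simp: polynomial_function_iff_Basis_inner Basis_vec_def inner_axis)

lemma polynomial_function_complex_iff:
  fixes f :: "'a::real_normed_vector \<Rightarrow> complex"
  shows "polynomial_function f \<longleftrightarrow>
    real_polynomial_function (\<lambda>x. Re (f x)) \<and> real_polynomial_function (\<lambda>x. Im (f x))"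
  by (simp add: polynomial_function_iff_Basis_inner Basis_complex_def inner_complex_def)

lemma real_polynomial_function_vec_nth: "real_polynomial_function (\<lambda>x::real^'n. x $ i)"
  by (intro real_polynomial_function.intros(1) bounded_linear_vec_nth)

lemma real_polynomial_function_Re_Im_nth:
  "real_polynomial_function (\<lambda>x::complex^'n. Re (x $ i))"
  "real_polynomial_function (\<lambda>x::complex^'n. Im (x $ i))"
  by (auto intro!: real_polynomial_function.intros(1) bounded_linear_vec_nth
      bounded_linear_compose[OF bounded_linear_Re] bounded_linear_compose[OF bounded_linear_Im])

lemmas polynomial_intros =
  real_polynomial_function.intros(2-4)
  real_polynomial_function_diff real_polynomial_function_minus real_polynomial_function_divide
  real_polynomial_function_power real_polynomial_function_vec_nth real_polynomial_function_Re_Im_nth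

text \<open>By the chain rule the differentials of \<open>f\<close> and \<open>g\<close> at
  corresponding points are mutually inverse, and the inverse of a map intertwining the two
  structures intertwines them the other way round.\<close>

lemma holomorphic_map_on_inverse:
  assumes hol: "holomorphic_map_on JA JB UNIV f" and smooth: "smooth_on UNIV g"
    and fg: "\<And>y. f (g y) = y" and gf: "\<And>x. g (f x) = x"
  shows "holomorphic_map_on JB JA UNIV g"
  unfolding holomorphic_map_on_def
proof (intro conjI ballI allI smooth)
  fix y v
  define Df where "Df = frechet_derivative f (at (g y))"
  define Dg where "Dg = frechet_derivative g (at y)"
  have f: "(f has_derivative Df) (at (g y))"
    using hol unfolding holomorphic_map_on_def Df_def by (auto intro: smooth_on_has_derivative)
  have g: "(g has_derivative Dg) (at y)"
    unfolding Dg_def by (rule smooth_on_has_derivative[OF smooth UNIV_I])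
  have "((\<lambda>y. f (g y)) has_derivative (\<lambda>v. Df (Dg v))) (at y)"
    by (rule has_derivative_compose[OF g f])
  then have "((\<lambda>y. y) has_derivative (\<lambda>v. Df (Dg v))) (at y)"
    by (simp add: fg)
  from has_derivative_unique[OF this has_derivative_ident]
  have Df_Dg: "Df (Dg w) = w" for w
    by (rule fun_cong)
  have "(g has_derivative Dg) (at (f (g y)))"
    using g by (simp add: fg)
  then have "((\<lambda>x. g (f x)) has_derivative (\<lambda>v. Dg (Df v))) (at (g y))"
    by (rule has_derivative_compose[OF f])
  then have "((\<lambda>x. x) has_derivative (\<lambda>v. Dg (Df v))) (at (g y))"
    by (simp add: gf)
  from has_derivative_unique[OF this has_derivative_ident]
  have Dg_Df: "Dg (Df w) = w" for w
    by (rule fun_cong)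
  have "Df (JA (g y) w) = JB y (Df w)" for w
    using hol by (simp add: holomorphic_map_on_def Df_def fg)
  then have "Dg (JB y v) = JA (g y) (Dg v)"
    by (metis Df_Dg Dg_Df)
  then show "frechet_derivative g (at y) (JB y v) = JA (g y) (frechet_derivative g (at y) v)"
    by (simp add: Dg_def)
qed

section \<open>Left invariant fields and the left invariant almost complex structure\<close>

lemma left_acs_G0: "G0.left_acs J p v = G0.left_field (J (v - (1/2) *\<^sub>R bracket63 p v)) p"
proof -
  have "((\<lambda>y. mult63 (- p) y) has_derivative (\<lambda>h. h + (1/2) *\<^sub>R bracket63 (- p) h)) (at p)"
    unfolding mult63_def
    by (auto intro!: derivative_eq_intros
        bounded_linear.has_derivative[OF bounded_bilinear.bounded_linear_right[OF bounded_bilinear_bracket63]])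
  then have "frechet_derivative (mult63 (- p)) (at p) v = v + (1/2) *\<^sub>R bracket63 (- p) v"
    by (rule fun_cong[OF frechet_derivative_at, symmetric])
  moreover have "bracket63 (- p) v = - bracket63 p v"
    by (simp add: vec_eq_iff forall_6)
  ultimately show ?thesis
    by (simp add: G0.left_acs_def G0.left_field_def)
qed

text \<open>The first-order brackets cancel, and the remaining multiple of
  \<open>bracket63 p (bracket63 p v)\<close> vanishes because brackets are central.\<close>

lemma left_field_G0_inverse: "G0.left_field (v - (1/2) *\<^sub>R bracket63 p v) p = v"
  by (simp add: left_field_G0 vec_eq_iff forall_6 algebra_simps diff_divide_distrib)

text \<open>Since \<open>lexp\<close> is the identity and \<open>mult63 p\<close> is affine, the
  curve defining \<open>left_deriv\<close> is a straight line through \<open>p\<close> with velocity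
  \<open>G0.left_field X p\<close>. This links holomorphic functions to Frechet derivatives.\<close>

lemma left_deriv_G0:
  assumes "(f has_derivative D) (at p)"
  shows "G0.left_deriv X f p = D (G0.left_field X p)"
proof -
  have line: "((\<lambda>t. mult63 p (t *\<^sub>R X)) has_vector_derivative G0.left_field X p) (at 0)"
  proof -
    have "mult63 p (t *\<^sub>R X) = p + t *\<^sub>R G0.left_field X p" for t
      by (simp add: mult63_def left_field_G0 vec_eq_iff forall_6 algebra_simps)
    then show ?thesis
      by (auto intro!: derivative_eq_intros)
  qed
  have "mult63 p (0 *\<^sub>R X) = p"
    by (simp add: mult63_def vec_eq_iff forall_6)
  then have "((\<lambda>t. f (mult63 p (t *\<^sub>R X))) has_vector_derivative D (G0.left_field X p)) (at 0)"
    using vector_derivative_diff_chain_within[OF line, of f D] assms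
    by (simp add: o_def has_derivative_at_withinI)
  then show ?thesis
    by (simp add: G0.left_deriv_def lexp_G0 vector_derivative_at)
qed

section \<open>Explicit form of the coordinates, of \<open>F\<close> and of its inverse\<close>

text \<open>The last three factors are central, so only the half brackets among the first three
  contribute.\<close>

lemma point_of_coords_eq: "point_of_coords a =
    a + (1/2) *\<^sub>R ((a$1 * a$2) *\<^sub>R bv 4 + (a$1 * a$3) *\<^sub>R bv 5 + (a$2 * a$3) *\<^sub>R bv 6)"
  unfolding point_of_coords_def lexp_G0
  by (simp add: mult63_def vec_eq_iff forall_6 axis_def)

text \<open>The quadratic correction involves only the first three entries, which
  \<open>point_of_coords\<close> leaves unchanged, so subtracting it inverts the map.\<close>

lemma coords_eq: "coords p =
    p - (1/2) *\<^sub>R ((p$1 * p$2) *\<^sub>R bv 4 + (p$1 * p$3) *\<^sub>R bv 5 + (p$2 * p$3) *\<^sub>R bv 6)" (is "_ = ?a")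
proof -
  have "point_of_coords ?a = p"
    by (simp add: point_of_coords_eq vec_eq_iff forall_6 axis_def)
  then show ?thesis
    unfolding coords_def by (metis bij_is_inj bij_point_of_coords inv_f_f)
qed

text \<open>With \<open>z1 = x + iy\<close>, the correction in \<open>w2\<close> is
  \<open>x^2/8 + 3 y^2/8 + i x y/4\<close>; its imaginary part combines with the
  \<open>- x y/2\<close> coming from \<open>coords\<close>.\<close>

lemma Re_Im_F:
  "Re (F p $ 1) = p$1" "Im (F p $ 1) = p$2"
  "Re (F p $ 2) = p$3 + (p$1)\<^sup>2 / 8 + 3 * (p$2)\<^sup>2 / 8" "Im (F p $ 2) = p$4 - p$1 * p$2 / 4"
  "Re (F p $ 3) = p$5 - p$1 * p$3 / 2" "Im (F p $ 3) = p$6 - p$2 * p$3 / 2"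
  by (simp_all add: F_def w1_def w2_def w3_def z1_def z2_def z3_def coords_eq axis_def
      cmod_power2 Re_power2 Im_power2 field_simps)

text \<open>The triangular system \<open>Re_Im_F\<close> solved for \<open>p\<close>;
  \<open>u\<close> is the third entry, on which the last two depend.\<close>

definition F_inv :: "complex^3 \<Rightarrow> real^6" where
  "F_inv w = (let x = Re (w$1); y = Im (w$1); u = Re (w$2) - x\<^sup>2 / 8 - 3 * y\<^sup>2 / 8 in
     x *\<^sub>R bv 1 + y *\<^sub>R bv 2 + u *\<^sub>R bv 3 + (Im (w$2) + x * y / 4) *\<^sub>R bv 4
     + (Re (w$3) + x * u / 2) *\<^sub>R bv 5 + (Im (w$3) + y * u / 2) *\<^sub>R bv 6)"

lemma F_inv_nth:
  "F_inv w $ 1 = Re (w$1)" "F_inv w $ 2 = Im (w$1)"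
  "F_inv w $ 3 = Re (w$2) - (Re (w$1))\<^sup>2 / 8 - 3 * (Im (w$1))\<^sup>2 / 8"
  "F_inv w $ 4 = Im (w$2) + Re (w$1) * Im (w$1) / 4"
  "F_inv w $ 5 = Re (w$3) + Re (w$1) * (Re (w$2) - (Re (w$1))\<^sup>2 / 8 - 3 * (Im (w$1))\<^sup>2 / 8) / 2"
  "F_inv w $ 6 = Im (w$3) + Im (w$1) * (Re (w$2) - (Re (w$1))\<^sup>2 / 8 - 3 * (Im (w$1))\<^sup>2 / 8) / 2"
  by (simp_all add: F_inv_def Let_def axis_def)

lemma F_F_inv: "F (F_inv w) = w"
  by (simp add: vec_eq_iff forall_3 complex_eq_iff Re_Im_F F_inv_nth)

lemma F_inv_F: "F_inv (F p) = p"
  by (simp add: vec_eq_iff forall_6 Re_Im_F F_inv_nth)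

lemma smooth_F: "smooth_on UNIV F"
  by (intro polynomial_function_smooth_on)
     (auto simp: polynomial_function_vec_iff forall_3 polynomial_function_complex_iff Re_Im_F
           intro!: polynomial_intros)

lemma smooth_F_inv: "smooth_on UNIV F_inv"
  by (intro polynomial_function_smooth_on)
     (auto simp: polynomial_function_vec_iff forall_6 F_inv_nth real_polynomial_function_eq[symmetric]
           intro!: polynomial_intros)

section \<open>The differential of \<open>F\<close> and holomorphy\<close>

lemma F_has_derivative: "(F has_derivative frechet_derivative F (at p)) (at p)"
  by (rule smooth_on_has_derivative[OF smooth_F UNIV_I])

lemma Re_Im_frechet_derivative_F:
  defines "D \<equiv> \<lambda>p. frechet_derivative F (at p)"
  shows "Re (D p h $ 1) = h$1" "Im (D p h $ 1) = h$2"
    "Re (D p h $ 2) = h$3 + p$1 * h$1 / 4 + 3 * (p$2 * h$2) / 4"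
    "Im (D p h $ 2) = h$4 - (p$1 * h$2 + p$2 * h$1) / 4"
    "Re (D p h $ 3) = h$5 - (p$1 * h$3 + p$3 * h$1) / 2"
    "Im (D p h $ 3) = h$6 - (p$2 * h$3 + p$3 * h$2) / 2"
proof -
  have nth: "((\<lambda>p::real^6. p $ i) has_derivative (\<lambda>h. h $ i)) (at p)" for i
    by (intro bounded_linear_imp_has_derivative bounded_linear_vec_nth)
  have comp: "((\<lambda>p. F p $ i) has_derivative (\<lambda>h. D p h $ i)) (at p)" for i
    unfolding D_def
    by (rule bounded_linear.has_derivative[OF bounded_linear_vec_nth F_has_derivative])
  \<comment> \<open>By uniqueness of derivatives, it suffices to differentiate the real polynomials
    of \<open>Re_Im_F\<close>.\<close>
  have Re: "Re (D p h $ i) = E h" if "((\<lambda>p. Re (F p $ i)) has_derivative E) (at p)" for E i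
    using has_derivative_unique[OF bounded_linear.has_derivative[OF bounded_linear_Re comp] that]
    by (rule fun_cong)
  have Im: "Im (D p h $ i) = E h" if "((\<lambda>p. Im (F p $ i)) has_derivative E) (at p)" for E i
    using has_derivative_unique[OF bounded_linear.has_derivative[OF bounded_linear_Im comp] that]
    by (rule fun_cong)
  show "Re (D p h $ 1) = h$1"
    by (rule Re) (simp add: Re_Im_F nth)
  show "Im (D p h $ 1) = h$2"
    by (rule Im) (simp add: Re_Im_F nth)
  show "Re (D p h $ 2) = h$3 + p$1 * h$1 / 4 + 3 * (p$2 * h$2) / 4"
    by (rule Re) (auto simp: Re_Im_F fun_eq_iff field_simps intro!: derivative_eq_intros nth)
  show "Im (D p h $ 2) = h$4 - (p$1 * h$2 + p$2 * h$1) / 4"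
    by (rule Im) (auto simp: Re_Im_F fun_eq_iff field_simps intro!: derivative_eq_intros nth)
  show "Re (D p h $ 3) = h$5 - (p$1 * h$3 + p$3 * h$1) / 2"
    by (rule Re) (auto simp: Re_Im_F fun_eq_iff field_simps intro!: derivative_eq_intros nth)
  show "Im (D p h $ 3) = h$6 - (p$2 * h$3 + p$3 * h$2) / 2"
    by (rule Im) (auto simp: Re_Im_F fun_eq_iff field_simps intro!: derivative_eq_intros nth)
qed

text \<open>Put \<open>a = X$1 + i X$2\<close>, \<open>b = X$3 + i X$4\<close>,
  \<open>c = X$5 + i X$6\<close>. On the left field of \<open>X\<close> the differential has
  components \<open>a\<close>, \<open>b + (p$1 - 3 i p$2) a / 4\<close> and
  \<open>c - p$3 a\<close>. These are complex linear in \<open>a\<close>, \<open>b\<close>,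
  \<open>c\<close>, each of which \<open>J0\<close> multiplies by \<open>i\<close>.\<close>

lemma frechet_derivative_F_left_field_J0:
  "frechet_derivative F (at p) (G0.left_field (J0 X) p) =
    \<i> *s frechet_derivative F (at p) (G0.left_field X p)"
  by (simp add: vec_eq_iff forall_3 complex_eq_iff Re_Im_frechet_derivative_F left_field_G0 field_simps)

text \<open>Every tangent vector \<open>v\<close> at \<open>p\<close> is the value there of the left
  field of \<open>X = v - [p, v]/2\<close>, and \<open>left_acs\<close> sends it to the value of the
  left field of \<open>J0 X\<close>.\<close>

lemma holomorphic_map_F: "holomorphic_map_on (G0.left_acs J0) std_acs UNIV F"
  by (simp add: holomorphic_map_on_def smooth_F left_acs_G0 std_acs_def
      frechet_derivative_F_left_field_J0 left_field_G0_inverse)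

lemma holomorphic_function_F_nth: "G0.holomorphic_function J0 (\<lambda>p. F p $ i)"
  unfolding G0.holomorphic_function_def
proof (intro conjI allI)
  have "\<forall>i. polynomial_function (\<lambda>p. F p $ i)"
    by (auto simp: forall_3 polynomial_function_complex_iff Re_Im_F intro!: polynomial_intros)
  then show "smooth_on UNIV (\<lambda>p. F p $ i)"
    by (intro polynomial_function_smooth_on) blast
next
  fix X p
  have "((\<lambda>p. F p $ i) has_derivative (\<lambda>h. frechet_derivative F (at p) h $ i)) (at p)"
    by (rule bounded_linear.has_derivative[OF bounded_linear_vec_nth F_has_derivative])
  from left_deriv_G0[OF this]
  show "G0.left_deriv X (\<lambda>p. F p $ i) p + \<i> * G0.left_deriv (J0 X) (\<lambda>p. F p $ i) p = 0"
    \<comment> \<open>The second term is \<open>\<i> * (\<i> * d)\<close>, where \<open>d\<close> is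
      the first, so the two cancel.\<close>
    by (simp add: frechet_derivative_F_left_field_J0 mult.assoc[symmetric])
qed

theorem mainTheorem13:
  shows "G0.holomorphic_function J0 w1 \<and> G0.holomorphic_function J0 w2 \<and>
         G0.holomorphic_function J0 w3 \<and>
         biholomorphic (G0.left_acs J0) std_acs UNIV UNIV F \<and>
         holomorphic_chart (G0.left_acs J0) UNIV F"
proof -
  have "bij F"
    by (rule bij_betw_byWitness[where f' = F_inv]) (auto simp: F_F_inv F_inv_F)
  \<comment> \<open>\<open>biholomorphic\<close> refers to \<open>inv_into\<close>, so holomorphy of
    the explicit inverse has to be transferred to it.\<close>
  moreover have "inv F = F_inv"
    by (rule inv_equality) (simp_all add: F_F_inv F_inv_F)
  moreover have "holomorphic_map_on std_acs (G0.left_acs J0) UNIV F_inv"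
    by (rule holomorphic_map_on_inverse[OF holomorphic_map_F smooth_F_inv F_F_inv F_inv_F])
  ultimately have "biholomorphic (G0.left_acs J0) std_acs UNIV UNIV F"
    by (simp add: biholomorphic_def holomorphic_map_F)
  \<comment> \<open>The target of a chart is its image, here all of the space by
    surjectivity.\<close>
  moreover from this have "holomorphic_chart (G0.left_acs J0) UNIV F"
    using bij_is_surj[OF \<open>bij F\<close>] by (simp add: holomorphic_chart_def)
  moreover have "w1 = (\<lambda>p. F p $ 1)" "w2 = (\<lambda>p. F p $ 2)" "w3 = (\<lambda>p. F p $ 3)"
    by (simp_all add: F_def)
  ultimately show ?thesis
    using holomorphic_function_F_nth by metis
qed

end
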